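(* For any $\widehat H\in\mathcal F_\diamond$ and any $\delta\in\mathbb R$ the element $H(\cdot,\delta)=\phi^\delta_{\xi_*}(\widehat H)\in\mathcal F$ is well-defined. For any $\mathbf k\in\mathbb Z^{2n}_\diamond$ the function $\mathcal H_{\mathbf k}(\delta)=H_{\mathbf k}(\delta)\,e^{\omega_{\mathbf k'}\delta}$ equals $$\mathcal H_{\mathbf k}(\delta)=\widehat H_{\mathbf k}+P_{\mathbf k}(\widehat H,\delta),$$ where $P_{\mathbf k}$ is a polynomial in the variables $\widehat H_{\mathbf m}$, $|\mathbf m|<|\mathbf k|$, with coefficients in the form of finite linear combinations of terms $\delta^s e^{-\nu\delta}$, $s\in\mathbb Z_+$. Here $\nu\ge 0$, and moreover, if a term $\delta^s e^{-\nu\delta}$ with $\nu=0$ appears in a coefficient of $P_{\mathbf k}$ with $\mathbf k'\in\mathbb L_\omega$, then in this term $s=0$.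
   Context: Fix $n\ge1$ and a vector $\omega\in\mathbb R^n$. $\mathbb Z_+=\{0,1,2,\dots\}$. For $\mathbf k=(k,\overline k)\in\mathbb Z_+^{2n}$, with $k,\overline k\in\mathbb Z_+^n$, put $|\mathbf k|=\sum_j(k_j+\overline k_j)$ and $\mathbf k'=\overline k-k\in\mathbb Z^n$. Put $\mathbb Z^{2n}_\diamond=\{\mathbf k\in\mathbb Z_+^{2n}:|\mathbf k|\ge3\}$ and $\mathbb L_\omega=\{q\in\mathbb Z^n:\langle\omega,q\rangle=0\}$. For $q\in\mathbb Z^n$ put $\sigma_q=\operatorname{sign}\langle\omega,q\rangle\in\{-1,0,1\}$ and $\omega_q=|\langle\omega,q\rangle|$. The variables $\mathbf z=(z,\overline z)=(z_1,\dots,z_n,\overline z_1,\dots,\overline z_n)$ are $2n$ independent variables (the bar is not conjugation), and $\mathbf z^{\mathbf k}=z^k\overline z^{\overline k}$. $\mathcal F=\mathbb C[[z,\overline z]]$ is the space of formal power series $H=\sum_{\mathbf k}H_{\mathbf k}\mathbf z^{\mathbf k}$, and $\mathcal F_\diamond\subset\mathcal F$ is the subspace of series with $H_{\mathbf k}=0$ for $|\mathbf k|\le2$. The Poisson bracket is $\{F,G\}=i\sum_{j=1}^n(\partial_{\overline z_j}F\,\partial_{z_j}G-\partial_{z_j}F\,\partial_{\overline z_j}G)$, and $H_2=\sum_{j=1}^n\omega_jz_j\overline z_j$. The operator $\xi_*$ on $\mathcal F_\diamond$ is $\xi_*H=-i\sum_{\mathbf k\in\mathbb Z^{2n}_\diamond}\sigma_{\mathbf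 k'}H_{\mathbf k}\mathbf z^{\mathbf k}$. Consider the initial value problem in $\mathcal F_\diamond$ $$\partial_\delta H=-\{\xi_*H,\,H_2+H\},\qquad H|_{\delta=0}=\widehat H,$$ understood coefficientwise: a solution on an interval $I\ni0$ is a path $\delta\mapsto H(\cdot,\delta)\in\mathcal F_\diamond$ with $H(\cdot,0)=\widehat H$ whose Taylor coefficients $H_{\mathbf k}(\delta)$ satisfy the ODEs obtained by equating the coefficients of each $\mathbf z^{\mathbf k}$ (each right-hand side involves finitely many coefficients of $H$). If the solution on $I$ exists and is unique, $\phi^\delta_{\xi_*}(\widehat H):=H(\cdot,\delta)$ for $\delta\in I$; "well-defined" refers to this existence and uniqueness. *)

theory Defs
  imports "HOL-Analysis.Analysis" "HOL-Library.Poly_Mapping"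
begin

text \<open>A multi-index \<open>(k, l)\<close> stands for the monomial \<open>z^k zbar^l\<close>; the index type \<open>'n\<close> has
  \<open>n = CARD('n) \<ge> 1\<close> elements.  A formal power series is its family of coefficients, so \<open>\<F>\<close> is
  the whole type \<open>'n series\<close>.\<close>

type_synonym 'n mindex = "(nat, 'n) vec \<times> (nat, 'n) vec"
type_synonym 'n series = "'n mindex \<Rightarrow> complex"

definition mdeg :: "'n::finite mindex \<Rightarrow> nat" where
  "mdeg k = (\<Sum>j\<in>UNIV. fst k $ j + snd k $ j)"

definition mdiff :: "'n::finite mindex \<Rightarrow> int ^ 'n" where
  "mdiff k = (\<chi> j. int (snd k $ j) - int (fst k $ j))"

definition Z_diamond :: "'n::finite mindex set" where
  "Z_diamond = {k. 3 \<le> mdeg k}"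

definition F_diamond :: "'n::finite series set" where
  "F_diamond = {H. \<forall>k. mdeg k \<le> 2 \<longrightarrow> H k = 0}"

definition freq :: "real ^ 'n::finite \<Rightarrow> int ^ 'n \<Rightarrow> real" where
  "freq \<omega> q = (\<Sum>j\<in>UNIV. \<omega> $ j * of_int (q $ j))"

definition L_res :: "real ^ 'n::finite \<Rightarrow> (int ^ 'n) set" where
  "L_res \<omega> = {q. freq \<omega> q = 0}"

text \<open>The Cauchy product; the index set of the sum is finite (lemma \<open>finite_mindex_decomp\<close>).\<close>

definition series_mult :: "'n::finite series \<Rightarrow> 'n series \<Rightarrow> 'n series" where
  "series_mult F G = (\<lambda>k. \<Sum>(l, m) | l + m = k. F l * G m)"

lemma finite_mindex_decomp:
  fixes k :: "'n::finite mindex"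
  shows "finite {(l, m). l + m = k}"
proof -
  let ?B = "\<lambda>v :: nat ^ 'n. vec_lambda ` (UNIV \<rightarrow>\<^sub>E {..Max (range (($) v))})"
  have fin: "finite (?B v)" for v
    by (intro finite_imageI finite_PiE) auto
  have mem: "u \<in> ?B v" if "\<And>j. u $ j \<le> v $ j" for u v
  proof (rule image_eqI)
    show "u = vec_lambda (($) u)" by simp
    show "($) u \<in> UNIV \<rightarrow>\<^sub>E {..Max (range (($) v))}"
      using that by (auto intro!: order_trans [OF that Max_ge])
  qed
  have "{(l, m). l + m = k} \<subseteq> (?B (fst k) \<times> ?B (snd k)) \<times> (?B (fst k) \<times> ?B (snd k))"
    by (auto intro!: mem)
  then show ?thesis
    by (rule finite_subset) (intro finite_cartesian_product fin)
qed

definition d_z :: "'n::finite \<Rightarrow> 'n series \<Rightarrow> 'n series" where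
  "d_z j F = (\<lambda>k. of_nat (fst k $ j + 1) * F (fst k + axis j 1, snd k))"

definition d_zbar :: "'n::finite \<Rightarrow> 'n series \<Rightarrow> 'n series" where
  "d_zbar j F = (\<lambda>k. of_nat (snd k $ j + 1) * F (fst k, snd k + axis j 1))"

definition poisson :: "'n::finite series \<Rightarrow> 'n series \<Rightarrow> 'n series" where
  "poisson F G = (\<lambda>k. \<i> * (\<Sum>j\<in>UNIV.
     series_mult (d_zbar j F) (d_z j G) k - series_mult (d_z j F) (d_zbar j G) k))"

definition H2 :: "real ^ 'n::finite \<Rightarrow> 'n series" where
  "H2 \<omega> = (\<lambda>k. \<Sum>j\<in>UNIV. if k = (axis j 1, axis j 1) then of_real (\<omega> $ j) else 0)"

definition xi_star :: "real ^ 'n::finite \<Rightarrow> 'n series \<Rightarrow> 'n series" where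
  "xi_star \<omega> H = (\<lambda>k. if k \<in> Z_diamond
     then - \<i> * of_real (sgn (freq \<omega> (mdiff k))) * H k else 0)"

definition solves :: "real ^ 'n::finite \<Rightarrow> 'n series \<Rightarrow> real set \<Rightarrow> (real \<Rightarrow> 'n series) \<Rightarrow> bool" where
  "solves \<omega> Hhat I H \<longleftrightarrow>
     (\<forall>\<delta>\<in>I. H \<delta> \<in> F_diamond) \<and> H 0 = Hhat \<and>
     (\<forall>\<delta>\<in>I. \<forall>k. ((\<lambda>t. H t k) has_vector_derivative
        - poisson (xi_star \<omega> (H \<delta>)) (\<lambda>m. H2 \<omega> m + H \<delta> m) k) (at \<delta> within I))"

text \<open>Uniqueness is up to the irrelevant values outside \<open>I\<close>.\<close>

definition uniquely_solvable :: "real ^ 'n::finite \<Rightarrow> 'n series \<Rightarrow> real set \<Rightarrow> bool" where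
  "uniquely_solvable \<omega> Hhat I \<longleftrightarrow>
     (\<exists>H. solves \<omega> Hhat I H) \<and>
     (\<forall>H G. solves \<omega> Hhat I H \<longrightarrow> solves \<omega> Hhat I G \<longrightarrow> (\<forall>\<delta>\<in>I. H \<delta> = G \<delta>))"

definition flow :: "real ^ 'n::finite \<Rightarrow> real \<Rightarrow> 'n series \<Rightarrow> 'n series" where
  "flow \<omega> \<delta> Hhat = (THE G. \<exists>I H. is_interval I \<and> 0 \<in> I \<and> \<delta> \<in> I \<and>
     uniquely_solvable \<omega> Hhat I \<and> solves \<omega> Hhat I H \<and> H \<delta> = G)"

text \<open>\<open>lookup c (s, \<nu>)\<close> is the coefficient of the term \<open>\<delta>^s exp (- \<nu> \<delta>)\<close>.\<close>

type_synonym exp_poly = "(nat \<times> real) \<Rightarrow>\<^sub>0 complex"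

definition eval_exp_poly :: "exp_poly \<Rightarrow> real \<Rightarrow> complex" where
  "eval_exp_poly c \<delta> =
     (\<Sum>(s, \<nu>)\<in>Poly_Mapping.keys c.
       Poly_Mapping.lookup c (s, \<nu>) * of_real (\<delta> ^ s * exp (- \<nu> * \<delta>)))"

text \<open>A formal polynomial in variables \<open>X m\<close> indexed by multi-indices \<open>m\<close>: the monomial
  \<open>\<mu>\<close> is the product of the \<open>X m ^ lookup \<mu> m\<close>, and \<open>lookup P \<mu>\<close> is its coefficient.\<close>

type_synonym 'n coeff_poly = "('n mindex \<Rightarrow>\<^sub>0 nat) \<Rightarrow>\<^sub>0 exp_poly"

definition eval_coeff_poly :: "'n::finite coeff_poly \<Rightarrow> 'n series \<Rightarrow> real \<Rightarrow> complex" where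
  "eval_coeff_poly P X \<delta> =
     (\<Sum>\<mu>\<in>Poly_Mapping.keys P. eval_exp_poly (Poly_Mapping.lookup P \<mu>) \<delta> *
       (\<Prod>m\<in>Poly_Mapping.keys \<mu>. X m ^ Poly_Mapping.lookup \<mu> m))"

end

theory Submission
  imports Defs
begin

text \<open>
  The coefficient equation reads \<open>H\<^sub>k' = - \<omega>\<^sub>k H\<^sub>k - Q\<^sub>k(H)\<close>, where \<open>\<omega>\<^sub>k\<close> is short for the absolute
  frequency of \<open>mdiff k\<close> and \<open>Q\<^sub>k\<close> is quadratic in coefficients of degree less than that of \<open>k\<close>. So
  it is triangular with respect to the degree, and the rescaled coefficient \<open>H\<^sub>k exp (\<omega>\<^sub>k t)\<close> is a
  primitive of an exponential polynomial, whose exponents are \<open>\<le> 0\<close> by the triangle inequality. If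
  \<open>\<omega>\<^sub>k = 0\<close>, every surviving term of \<open>Q\<^sub>k\<close> decays strictly, so integration creates no power of \<open>t\<close>
  without exponential decay.
\<close>

subsection \<open>Exponential polynomials\<close>

definition monom_eval :: "('v \<Rightarrow>\<^sub>0 nat) \<Rightarrow> ('v \<Rightarrow> complex) \<Rightarrow> complex" where
  "monom_eval \<mu> X = (\<Prod>m\<in>Poly_Mapping.keys \<mu>. X m ^ Poly_Mapping.lookup \<mu> m)"

lemma monom_eval_superset:
  assumes "finite S" "Poly_Mapping.keys \<mu> \<subseteq> S"
  shows "monom_eval \<mu> X = (\<Prod>m\<in>S. X m ^ Poly_Mapping.lookup \<mu> m)"
  unfolding monom_eval_def
  by (rule prod.mono_neutral_left) (use assms in \<open>auto simp: in_keys_iff\<close>)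

lemma monom_eval_zero [simp]: "monom_eval 0 X = 1"
  by (simp add: monom_eval_def)

lemma monom_eval_single [simp]: "monom_eval (Poly_Mapping.single m (Suc 0)) X = X m"
  by (simp add: monom_eval_def)

lemma monom_eval_add: "monom_eval (\<mu> + \<mu>') X = monom_eval \<mu> X * monom_eval \<mu>' X"
proof -
  let ?S = "Poly_Mapping.keys \<mu> \<union> Poly_Mapping.keys \<mu>'"
  have "monom_eval (\<mu> + \<mu>') X = (\<Prod>m\<in>?S. X m ^ Poly_Mapping.lookup (\<mu> + \<mu>') m)"
    by (rule monom_eval_superset) (auto dest: Poly_Mapping.keys_add [THEN subsetD])
  also have "\<dots> = (\<Prod>m\<in>?S. X m ^ Poly_Mapping.lookup \<mu> m) * (\<Prod>m\<in>?S. X m ^ Poly_Mapping.lookup \<mu>' m)"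
    by (simp add: lookup_add power_add prod.distrib)
  also have "\<dots> = monom_eval \<mu> X * monom_eval \<mu>' X"
    by (simp add: monom_eval_superset [of ?S])
  finally show ?thesis .
qed

text \<open>Semantic counterpart of \<open>coeff_poly\<close>: functions of the initial data
  \<open>X\<close> and the time \<open>t\<close>, with \<open>A\<close> restricting the variables
  and \<open>B\<close> the pairs \<open>(s, \<nu>)\<close>. Closure under sums, products and
  integration then follows by induction, without handling coefficients of formal
  polynomials.\<close>

inductive_set exp_polys :: "'v set \<Rightarrow> (nat \<times> real) set \<Rightarrow> (('v \<Rightarrow> complex) \<Rightarrow> real \<Rightarrow> complex) set"
  for A B where
  zero: "(\<lambda>X t. 0) \<in> exp_polys A B"
| add_term: "\<lbrakk>f \<in> exp_polys A B; Poly_Mapping.keys \<mu> \<subseteq> A; (s, \<nu>) \<in> B\<rbrakk> \<Longrightarrow>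
    (\<lambda>X t. f X t + c * of_real (t ^ s * exp (- \<nu> * t)) * monom_eval \<mu> X) \<in> exp_polys A B"

lemma exp_polys_term:
  "\<lbrakk>Poly_Mapping.keys \<mu> \<subseteq> A; (s, \<nu>) \<in> B\<rbrakk> \<Longrightarrow>
    (\<lambda>X t. c * of_real (t ^ s * exp (- \<nu> * t)) * monom_eval \<mu> X) \<in> exp_polys A B"
  using exp_polys.add_term [OF exp_polys.zero, of \<mu> A s \<nu> B c] by simp

lemma exp_polys_mono:
  assumes "f \<in> exp_polys A B" "A \<subseteq> A'" "B \<subseteq> B'"
  shows "f \<in> exp_polys A' B'"
  using assms(1)
proof induction
  case (add_term f \<mu> s \<nu> c)
  show ?case
    by (rule exp_polys.add_term) (use add_term assms(2,3) in auto)
qed (rule exp_polys.zero)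

lemma exp_polys_add:
  assumes "f \<in> exp_polys A B" "g \<in> exp_polys A B"
  shows "(\<lambda>X t. f X t + g X t) \<in> exp_polys A B"
  using assms(2)
proof induction
  case (add_term g \<mu> s \<nu> c)
  from exp_polys.add_term [OF add_term.IH add_term.hyps(2,3), of c]
  show ?case by (simp add: add.assoc)
qed (use assms(1) in simp)

lemma exp_polys_sum:
  assumes "\<And>i. i \<in> S \<Longrightarrow> f i \<in> exp_polys A B"
  shows "(\<lambda>X t. \<Sum>i\<in>S. f i X t) \<in> exp_polys A B"
  using assms
  by (induction S rule: infinite_finite_induct) (auto intro: exp_polys.zero exp_polys_add)

lemma exp_polys_cmult:
  assumes "f \<in> exp_polys A B"
  shows "(\<lambda>X t. a * f X t) \<in> exp_polys A B"
  using assms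
proof induction
  case (add_term f \<mu> s \<nu> c)
  from exp_polys.add_term [OF add_term.IH add_term.hyps(2,3), of "a * c"]
  show ?case by (simp add: algebra_simps)
qed (simp add: exp_polys.zero)

lemma exp_polys_diff:
  assumes "f \<in> exp_polys A B" "g \<in> exp_polys A B"
  shows "(\<lambda>X t. f X t - g X t) \<in> exp_polys A B"
  using exp_polys_add [OF assms(1) exp_polys_cmult [OF assms(2), of "-1"]] by simp

text \<open>Two terms multiply to a single term in which powers, rates and monomials add, so
  \<open>BB\<close> is all that the exponent sets must satisfy. The outer induction splits
  \<open>f\<close>, the inner one \<open>g\<close>.\<close>

lemma exp_polys_mult:
  assumes f: "f \<in> exp_polys A B" and g: "g \<in> exp_polys A B'"
    and BB: "\<And>s \<nu> s' \<nu>'. (s, \<nu>) \<in> B \<Longrightarrow> (s', \<nu>') \<in> B' \<Longrightarrow> (s + s', \<nu> + \<nu>') \<in> B''"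
  shows "(\<lambda>X t. f X t * g X t) \<in> exp_polys A B''"
  using f
proof induction
  case (add_term f \<mu> s \<nu> c)
  have "(\<lambda>X t. c * of_real (t ^ s * exp (- \<nu> * t)) * monom_eval \<mu> X * g X t) \<in> exp_polys A B''"
    using g
  proof induction
    case (add_term g \<mu>' s' \<nu>' c')
    have "Poly_Mapping.keys (\<mu> + \<mu>') \<subseteq> A"
      using Poly_Mapping.keys_add [of \<mu> \<mu>'] \<open>Poly_Mapping.keys \<mu> \<subseteq> A\<close> add_term.hyps(2) by blast
    note exp_polys.add_term [OF add_term.IH this BB [OF \<open>(s, \<nu>) \<in> B\<close> add_term.hyps(3)], of "c * c'"]
    moreover have "c * of_real (t ^ s * exp (- \<nu> * t)) * monom_eval \<mu> X
          * (g X t + c' * of_real (t ^ s' * exp (- \<nu>' * t)) * monom_eval \<mu>' X) =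
        c * of_real (t ^ s * exp (- \<nu> * t)) * monom_eval \<mu> X * g X t
          + c * c' * of_real (t ^ (s + s') * exp (- (\<nu> + \<nu>') * t)) * monom_eval (\<mu> + \<mu>') X" for X t
    proof -
      have "exp (- (\<nu> + \<nu>') * t) = exp (- \<nu> * t) * exp (- \<nu>' * t)"
        by (simp add: algebra_simps flip: exp_add)
      then show ?thesis
        by (simp add: algebra_simps power_add monom_eval_add)
    qed
    ultimately show ?case by simp
  qed (simp add: exp_polys.zero)
  from exp_polys_add [OF add_term.IH this] show ?case
    by (simp add: algebra_simps)
qed (simp add: exp_polys.zero)

lemma exp_polys_exp: "(0, \<nu>) \<in> B \<Longrightarrow> (\<lambda>X t. of_real (exp (- \<nu> * t))) \<in> exp_polys A B"
  using exp_polys_term [of 0 A 0 \<nu> B 1] by simp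

lemma exp_polys_var: "m \<in> A \<Longrightarrow> (0, 0) \<in> B \<Longrightarrow> (\<lambda>X t. X m) \<in> exp_polys A B"
  using exp_polys_term [of "Poly_Mapping.single m (Suc 0)" A 0 0 B 1] by simp

section \<open>Primitives of exponential polynomials\<close>

lemma exp_monom_primitive_zero:
  "((\<lambda>t. t ^ Suc s / real (Suc s)) has_real_derivative t ^ s) (at t)"
  by (rule derivative_eq_intros refl | simp)+

text \<open>Repeated integration by parts. The condition \<open>d + c 0 = 0\<close> says that the
  primitive vanishes at \<open>t = 0\<close>, where only the power \<open>i = 0\<close>
  contributes.\<close>

lemma exp_monom_primitive_pos:
  assumes "0 < \<nu>"
  shows "\<exists>c d. \<forall>t. ((\<lambda>t. d + (\<Sum>i\<le>s. c i * (t ^ i * exp (- \<nu> * t)))) has_real_derivative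
      t ^ s * exp (- \<nu> * t)) (at t) \<and> d + c 0 = 0"
proof (induction s)
  case 0
  have "((\<lambda>t. 1 / \<nu> + (\<Sum>i\<le>0. (- 1 / \<nu>) * (t ^ i * exp (- \<nu> * t)))) has_real_derivative
      t ^ 0 * exp (- \<nu> * t)) (at t)" for t
    by (rule derivative_eq_intros refl | use assms in simp)+
  then show ?case
    by (intro exI [of _ "\<lambda>_. - 1 / \<nu>"] exI [of _ "1 / \<nu>"]) simp
next
  case (Suc s)
  then obtain c d where cd: "\<And>t. ((\<lambda>t. d + (\<Sum>i\<le>s. c i * (t ^ i * exp (- \<nu> * t)))) has_real_derivative
      t ^ s * exp (- \<nu> * t)) (at t)" and d: "d + c 0 = 0"
    by blast
  \<comment> \<open>Integration by parts: a primitive of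
    \<open>t ^ Suc s * exp (- \<nu> * t)\<close> is \<open>a\<close> times the previous primitive
    minus \<open>t ^ Suc s * exp (- \<nu> * t) / \<nu>\<close>. This dictates
    \<open>c'\<close>.\<close>
  define a where "a = real (Suc s) / \<nu>"
  define c' where "c' = (\<lambda>i. if i = Suc s then - 1 / \<nu> else a * c i)"
  have eq: "(\<lambda>t. a * d + (\<Sum>i\<le>Suc s. c' i * (t ^ i * exp (- \<nu> * t)))) =
      (\<lambda>t. a * (d + (\<Sum>i\<le>s. c i * (t ^ i * exp (- \<nu> * t)))) - t ^ Suc s * exp (- \<nu> * t) / \<nu>)"
    by (rule ext) (simp add: c'_def distrib_left sum_distrib_left mult.assoc)
  have "((\<lambda>t. a * d + (\<Sum>i\<le>Suc s. c' i * (t ^ i * exp (- \<nu> * t)))) has_real_derivative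
      t ^ Suc s * exp (- \<nu> * t)) (at t)" for t
  proof -
    have "((\<lambda>t. t ^ Suc s * exp (- \<nu> * t) / \<nu>) has_real_derivative
        a * (t ^ s * exp (- \<nu> * t)) - t ^ Suc s * exp (- \<nu> * t)) (at t)"
      by (rule derivative_eq_intros refl | use assms in \<open>simp add: a_def field_simps\<close>)+
    from DERIV_diff [OF DERIV_cmult [OF cd, of a] this] show ?thesis
      unfolding eq by simp
  qed
  moreover have "a * d + c' 0 = 0"
    using d by (simp add: c'_def flip: distrib_left)
  ultimately show ?case by blast
qed

text \<open>A pure power gains one degree. A term with \<open>\<nu> > 0\<close> keeps its rate and
  gains no degree, but normalising its primitive to 0 at \<open>t = 0\<close> adds a constant, hence
  the demand \<open>(0, 0) \<in> B'\<close>.\<close>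

lemma exp_polys_primitive:
  assumes f: "f \<in> exp_polys A B"
    and zero: "\<And>s. (s, 0) \<in> B \<Longrightarrow> (Suc s, 0) \<in> B'"
    and pos: "\<And>s \<nu> i. (s, \<nu>) \<in> B \<Longrightarrow> \<nu> \<noteq> 0 \<Longrightarrow> i \<le> s \<Longrightarrow> 0 < \<nu> \<and> (0, 0) \<in> B' \<and> (i, \<nu>) \<in> B'"
  shows "\<exists>F \<in> exp_polys A B'. \<forall>X. F X 0 = 0 \<and> (\<forall>t. (F X has_vector_derivative f X t) (at t))"
  using f
proof induction
  case zero
  then show ?case
    by (intro bexI [OF _ exp_polys.zero]) auto
next
  case (add_term f \<mu> s \<nu> c)
  obtain G :: "real \<Rightarrow> real" where G0: "G 0 = 0"
    and G: "\<And>t. (G has_real_derivative t ^ s * exp (- \<nu> * t)) (at t)"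
    and GB: "(\<lambda>X t. c * of_real (G t) * monom_eval \<mu> X) \<in> exp_polys A B'"
  proof (cases "\<nu> = 0")
    case True
    have "(\<lambda>X t. c * of_real (t ^ Suc s / real (Suc s)) * monom_eval \<mu> X) \<in> exp_polys A B'"
      using exp_polys_term [of \<mu> A "Suc s" 0 B' "c / of_nat (Suc s)"] zero add_term.hyps True
      by simp
    with exp_monom_primitive_zero [of s] show ?thesis
      using True by (intro that [of "\<lambda>t. t ^ Suc s / real (Suc s)"]) simp_all
  next
    case False
    with pos [OF add_term.hyps(3)] have \<nu>: "0 < \<nu>" and B': "(0, 0) \<in> B'" "\<And>i. i \<le> s \<Longrightarrow> (i, \<nu>) \<in> B'"
      by auto
    obtain a d where a: "\<And>t. ((\<lambda>t. d + (\<Sum>i\<le>s. a i * (t ^ i * exp (- \<nu> * t)))) has_real_derivative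
      t ^ s * exp (- \<nu> * t)) (at t)" and d: "d + a 0 = 0"
      using exp_monom_primitive_pos [OF \<nu>, of s] by blast
    have "(\<lambda>X t. (c * of_real d) * of_real (t ^ 0 * exp (- 0 * t)) * monom_eval \<mu> X
        + (\<Sum>i\<le>s. (c * of_real (a i)) * of_real (t ^ i * exp (- \<nu> * t)) * monom_eval \<mu> X))
        \<in> exp_polys A B'"
      using B' add_term.hyps by (intro exp_polys_add exp_polys_sum exp_polys_term) auto
    then have "(\<lambda>X t. c * of_real (d + (\<Sum>i\<le>s. a i * (t ^ i * exp (- \<nu> * t)))) * monom_eval \<mu> X)
        \<in> exp_polys A B'"
      by (simp add: algebra_simps sum_distrib_left sum_distrib_right)
    \<comment> \<open>Only \<open>i = 0\<close> survives, because \<open>0 ^ 0 = 1\<close>; together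
      with \<open>d\<close> this gives \<open>G 0 = 0\<close>.\<close>
    moreover have "(\<Sum>i\<le>s. a i * (0 ^ i * exp (- \<nu> * 0))) = a 0"
    proof -
      have "(\<Sum>i\<le>s. a i * (0 ^ i * exp (- \<nu> * 0))) = (\<Sum>i\<le>s. if i = 0 then a 0 else 0)"
        by (rule sum.cong) auto
      then show ?thesis by simp
    qed
    ultimately show ?thesis
      using a d by (intro that [of "\<lambda>t. d + (\<Sum>i\<le>s. a i * (t ^ i * exp (- \<nu> * t)))"]) simp_all
  qed
  from add_term.IH obtain F where F: "F \<in> exp_polys A B'" "\<And>X. F X 0 = 0"
    "\<And>X t. (F X has_vector_derivative f X t) (at t)"
    by blast
  have "((\<lambda>t. F X t + c * of_real (G t) * monom_eval \<mu> X) has_vector_derivative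
      f X t + c * of_real (t ^ s * exp (- \<nu> * t)) * monom_eval \<mu> X) (at t)" for X t
    by (intro derivative_intros F has_vector_derivative_mult_left has_vector_derivative_mult_right
        has_vector_derivative_of_real) (use G in \<open>simp add: has_real_derivative_iff_has_vector_derivative\<close>)
  then show ?case
    by (intro bexI [OF _ exp_polys_add [OF F(1) GB]]) (simp add: F(2) G0)
qed

section \<open>Evaluation of formal coefficient polynomials\<close>

lemma eval_exp_poly_superset:
  assumes "finite S" "Poly_Mapping.keys c \<subseteq> S"
  shows "eval_exp_poly c t =
    (\<Sum>(s, \<nu>)\<in>S. Poly_Mapping.lookup c (s, \<nu>) * of_real (t ^ s * exp (- \<nu> * t)))"
  unfolding eval_exp_poly_def
  by (rule sum.mono_neutral_left) (use assms in \<open>auto simp: in_keys_iff\<close>)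

lemma eval_exp_poly_zero [simp]: "eval_exp_poly 0 t = 0"
  by (simp add: eval_exp_poly_def)

lemma eval_exp_poly_single:
  "eval_exp_poly (Poly_Mapping.single (s, \<nu>) c) t = c * of_real (t ^ s * exp (- \<nu> * t))"
  by (simp add: eval_exp_poly_superset [of "{(s, \<nu>)}"])

lemma eval_exp_poly_add: "eval_exp_poly (c + d) t = eval_exp_poly c t + eval_exp_poly d t"
proof -
  let ?S = "Poly_Mapping.keys c \<union> Poly_Mapping.keys d"
  have "Poly_Mapping.keys (c + d) \<subseteq> ?S"
    by (rule Poly_Mapping.keys_add)
  then show ?thesis
    by (simp add: eval_exp_poly_superset [of ?S] lookup_add split_def distrib_right sum.distrib)
qed

lemma eval_coeff_poly_superset:
  assumes "finite S" "Poly_Mapping.keys P \<subseteq> S"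
  shows "eval_coeff_poly P X t =
    (\<Sum>\<mu>\<in>S. eval_exp_poly (Poly_Mapping.lookup P \<mu>) t * monom_eval \<mu> X)"
  unfolding eval_coeff_poly_def monom_eval_def
  by (rule sum.mono_neutral_left) (use assms in \<open>auto simp: in_keys_iff\<close>)

lemma eval_coeff_poly_single:
  "eval_coeff_poly (Poly_Mapping.single \<mu> c) X t = eval_exp_poly c t * monom_eval \<mu> X"
  by (simp add: eval_coeff_poly_superset [of "{\<mu>}"])

lemma eval_coeff_poly_add:
  "eval_coeff_poly (P + Q) X t = eval_coeff_poly P X t + eval_coeff_poly Q X t"
proof -
  let ?S = "Poly_Mapping.keys P \<union> Poly_Mapping.keys Q"
  have "Poly_Mapping.keys (P + Q) \<subseteq> ?S"
    by (rule Poly_Mapping.keys_add)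
  then show ?thesis
    by (simp add: eval_coeff_poly_superset [of ?S] lookup_add eval_exp_poly_add distrib_right sum.distrib)
qed

text \<open>The way back from functions to formal polynomials: each \<open>add_term\<close> adds a
  nested \<open>single\<close>. Cancellation is harmless, since it only shrinks the sets of
  keys.\<close>

lemma exp_polys_imp_coeff_poly:
  assumes "f \<in> exp_polys A B"
  shows "\<exists>P. (\<forall>\<mu> \<in> Poly_Mapping.keys P. Poly_Mapping.keys \<mu> \<subseteq> A \<and>
      Poly_Mapping.keys (Poly_Mapping.lookup P \<mu>) \<subseteq> B) \<and> (\<forall>X t. f X t = eval_coeff_poly P X t)"
  using assms
proof induction
  case zero
  show ?case by (rule exI [of _ 0]) (simp add: eval_coeff_poly_def)
next
  case (add_term f \<mu> s \<nu> c)
  \<comment> \<open>The bound by \<open>B\<close> is taken for every monomial: off the keys of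
    \<open>P\<close> the coefficient is 0 and has no keys. So it does not matter whether the new
    monomial already occurs in \<open>P\<close>.\<close>
  then obtain P where P: "\<And>\<mu>. \<mu> \<in> Poly_Mapping.keys P \<Longrightarrow> Poly_Mapping.keys \<mu> \<subseteq> A"
    "\<And>\<mu>. Poly_Mapping.keys (Poly_Mapping.lookup P \<mu>) \<subseteq> B" "\<And>X t. f X t = eval_coeff_poly P X t"
    by (metis empty_subsetI in_keys_iff keys_zero)
  let ?Q = "Poly_Mapping.single \<mu> (Poly_Mapping.single (s, \<nu>) c)"
  have "Poly_Mapping.keys (Poly_Mapping.lookup (P + ?Q) \<mu>') \<subseteq> B" for \<mu>'
    using P(2) [of \<mu>'] add_term.hyps(3)
      Poly_Mapping.keys_add [of "Poly_Mapping.lookup P \<mu>'" "Poly_Mapping.lookup ?Q \<mu>'"]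
    by (auto simp: lookup_add lookup_single when_def split: if_splits)
  moreover have "Poly_Mapping.keys \<mu>' \<subseteq> A" if "\<mu>' \<in> Poly_Mapping.keys (P + ?Q)" for \<mu>'
    using that Poly_Mapping.keys_add [of P ?Q] P(1) add_term.hyps(2) by (auto split: if_splits)
  ultimately show ?case
    by (intro exI [of _ "P + ?Q"])
      (simp add: P(3) eval_coeff_poly_add eval_coeff_poly_single eval_exp_poly_single)
qed

subsection \<open>The Poisson bracket and the degree grading\<close>

lemma mdeg_add: "mdeg (k + l) = mdeg k + mdeg l"
  by (simp add: mdeg_def sum.distrib)

lemma freq_add: "freq \<omega> (p + q) = freq \<omega> p + freq \<omega> q"
  by (simp add: freq_def sum.distrib distrib_left)

lemma mdeg_axis: "mdeg (axis j 1, 0) = 1" "mdeg (0, axis j 1) = 1"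
  by (simp_all add: mdeg_def axis_def sum.delta)

text \<open>Each term of the bracket loses one variable \<open>z\<close> and one \<open>zbar\<close>
  with the same \<open>j\<close>; their contributions to \<open>mdiff\<close> cancel. Hence the
  bracket respects the grading by \<open>mdiff\<close>.\<close>

lemma mdiff_add_axis:
  "mdiff (l + (axis j 1, 0)) + mdiff (m + (0, axis j 1)) = mdiff (l + m)"
  "mdiff (l + (0, axis j 1)) + mdiff (m + (axis j 1, 0)) = mdiff (l + m)"
  by (simp_all add: mdiff_def vec_eq_iff axis_def)

lemma d_z_altdef: "d_z j F k = of_nat (fst k $ j + 1) * F (k + (axis j 1, 0))"
  by (cases k) (simp add: d_z_def)

lemma d_zbar_altdef: "d_zbar j F k = of_nat (snd k $ j + 1) * F (k + (0, axis j 1))"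
  by (cases k) (simp add: d_zbar_def)

text \<open>With everything under one double sum, later proofs can treat the bracket summand by
  summand.\<close>

lemma poisson_expand:
  "poisson F G k = (\<Sum>j\<in>UNIV. \<Sum>(l, m) | l + m = k.
     \<i> * of_nat (snd l $ j + 1) * of_nat (fst m $ j + 1) * (F (l + (0, axis j 1)) * G (m + (axis j 1, 0)))
     - \<i> * of_nat (fst l $ j + 1) * of_nat (snd m $ j + 1) * (F (l + (axis j 1, 0)) * G (m + (0, axis j 1))))"
proof -
  have *: "\<i> * ((a * x) * (b * y) - (c * u) * (d * v)) = \<i> * a * b * (x * y) - \<i> * c * d * (u * v)"
    for a b c d x y u v :: complex
    by (simp add: algebra_simps)
  show ?thesis
    unfolding poisson_def series_mult_def d_z_altdef d_zbar_altdef sum_subtractf [symmetric]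
      sum_distrib_left split_def * ..
qed

lemma poisson_add_right: "poisson F (\<lambda>m. G m + H m) k = poisson F G k + poisson F H k"
proof -
  have *: "c * (a * (x + y)) - d * (b * (u + v)) = (c * (a * x) - d * (b * u)) + (c * (a * y) - d * (b * v))"
    for a b c d x y u v :: complex
    by (simp add: algebra_simps)
  show ?thesis
    unfolding poisson_expand sum.distrib [symmetric] split_def * ..
qed

section \<open>Bracket with \<open>H2\<close>\<close>

lemma nat_vec_add_axis_eq_axis_iff:
  fixes a :: "nat ^ 'n::finite"
  shows "a + axis j 1 = axis i 1 \<longleftrightarrow> a = 0 \<and> i = j"
proof
  assume h: "a + axis j 1 = axis i 1"
  from arg_cong [OF this, of "\<lambda>v. v $ j"] have "i = j"
    by (auto simp: axis_def split: if_splits)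
  with h show "a = 0 \<and> i = j" by simp
qed simp

lemma d_z_H2: "d_z j (H2 \<omega>) = (\<lambda>k. if k = (0, axis j 1) then of_real (\<omega> $ j) else 0)"
proof
  fix k :: "'a mindex"
  have iff: "(fst k + axis j 1, snd k) = (axis i 1, axis i 1) \<longleftrightarrow> i = j \<and> k = (0, axis j 1)" for i
    unfolding prod.inject nat_vec_add_axis_eq_axis_iff by (cases k) auto
  have "H2 \<omega> (fst k + axis j 1, snd k) =
      (\<Sum>i\<in>UNIV. if i = j then (if k = (0, axis j 1) then of_real (\<omega> $ j) else 0) else 0)"
    unfolding H2_def iff by (intro sum.cong refl) simp
  then show "d_z j (H2 \<omega>) k = (if k = (0, axis j 1) then of_real (\<omega> $ j) else 0)"
    by (auto simp: d_z_def)
qed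

lemma d_zbar_H2: "d_zbar j (H2 \<omega>) = (\<lambda>k. if k = (axis j 1, 0) then of_real (\<omega> $ j) else 0)"
proof
  fix k :: "'a mindex"
  have iff: "(fst k, snd k + axis j 1) = (axis i 1, axis i 1) \<longleftrightarrow> i = j \<and> k = (axis j 1, 0)" for i
    unfolding prod.inject nat_vec_add_axis_eq_axis_iff by (cases k) auto
  have "H2 \<omega> (fst k, snd k + axis j 1) =
      (\<Sum>i\<in>UNIV. if i = j then (if k = (axis j 1, 0) then of_real (\<omega> $ j) else 0) else 0)"
    unfolding H2_def iff by (intro sum.cong refl) simp
  then show "d_zbar j (H2 \<omega>) k = (if k = (axis j 1, 0) then of_real (\<omega> $ j) else 0)"
    by (auto simp: d_zbar_def)
qed

lemma series_mult_monomial: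
  "series_mult F (\<lambda>k. if k = p then c else 0) (l + p) = F l * c"
proof -
  have "series_mult F (\<lambda>k. if k = p then c else 0) (l + p) =
      (\<Sum>(l', m) \<in> {(l, p)}. F l' * (if m = p then c else 0))"
    unfolding series_mult_def
    by (rule sum.mono_neutral_right [OF finite_mindex_decomp])
      (cases l; cases p; auto split: if_splits)+
  then show ?thesis by simp
qed

lemma series_mult_monomial_zero:
  assumes "\<And>l. k \<noteq> l + p"
  shows "series_mult F (\<lambda>k. if k = p then c else 0) k = 0"
  unfolding series_mult_def
proof (intro sum.neutral ballI)
  fix x
  assume "x \<in> {(l, m). l + m = k}"
  then have "snd x \<noteq> p"
    using assms [of "fst x"] by (auto simp: split_def)
  then show "(case x of (l, m) \<Rightarrow> F l * (if m = p then c else 0)) = 0"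
    by (simp add: split_def)
qed

lemma nat_vec_diff_axis:
  fixes a :: "nat ^ 'n::finite"
  assumes "a $ j \<noteq> 0"
  obtains b where "a = b + axis j 1"
proof
  show "a = (\<chi> i. if i = j then a $ i - 1 else a $ i) + axis j 1"
    using assms by (simp add: vec_eq_iff axis_def)
qed

text \<open>Differentiation removes one factor \<open>zbar\<close>, and multiplication by the
  monomial \<open>d_z j (H2 \<omega>)\<close> restores it, so only the exponent remains as a factor.
  At exponent 0 both sides vanish.\<close>

lemma series_mult_d_zbar_d_z_H2:
  "series_mult (d_zbar j F) (d_z j (H2 \<omega>)) k = of_nat (snd k $ j) * of_real (\<omega> $ j) * F k"
proof (cases "snd k $ j = 0")
  case True
  have "k \<noteq> l + (0, axis j 1)" for l
    using True by auto
  then show ?thesis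
    unfolding d_z_H2 by (simp add: series_mult_monomial_zero True)
next
  case False
  then obtain b where b: "snd k = b + axis j 1"
    by (rule nat_vec_diff_axis)
  define l where "l = (fst k, b)"
  have k: "k = l + (0, axis j 1)"
    by (simp add: l_def b prod_eq_iff)
  show ?thesis
    unfolding k d_z_H2 series_mult_monomial d_zbar_altdef by simp
qed

lemma series_mult_d_z_d_zbar_H2:
  "series_mult (d_z j F) (d_zbar j (H2 \<omega>)) k = of_nat (fst k $ j) * of_real (\<omega> $ j) * F k"
proof (cases "fst k $ j = 0")
  case True
  have "k \<noteq> l + (axis j 1, 0)" for l
    using True by auto
  then show ?thesis
    unfolding d_zbar_H2 by (simp add: series_mult_monomial_zero True)
next
  case False
  then obtain b where b: "fst k = b + axis j 1"
    by (rule nat_vec_diff_axis)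
  define l where "l = (b, snd k)"
  have k: "k = l + (axis j 1, 0)"
    by (simp add: l_def b prod_eq_iff)
  show ?thesis
    unfolding k d_zbar_H2 series_mult_monomial d_z_altdef by simp
qed

text \<open>Monomials are eigenvectors of the bracket with \<open>H2\<close>: for each
  \<open>j\<close> the two exponents subtract to the entry of \<open>mdiff k\<close>.\<close>

lemma poisson_H2: "poisson F (H2 \<omega>) k = \<i> * of_real (freq \<omega> (mdiff k)) * F k"
  unfolding poisson_def series_mult_d_zbar_d_z_H2 series_mult_d_z_d_zbar_H2
    freq_def mdiff_def of_real_sum sum_distrib_left sum_distrib_right
  by (intro sum.cong refl) (simp add: algebra_simps)

section \<open>Quadratic part of the equation\<close>

definition quad :: "real ^ 'n::finite \<Rightarrow> 'n series \<Rightarrow> 'n series" where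
  "quad \<omega> H = poisson (xi_star \<omega> H) H"

definition truncate :: "nat \<Rightarrow> 'n::finite series \<Rightarrow> 'n series" where
  "truncate d H = (\<lambda>m. if mdeg m < d then H m else 0)"

lemma F_diamond_eq_0:
  assumes "H \<in> F_diamond" "k \<notin> Z_diamond"
  shows "H k = 0"
proof -
  have "mdeg k \<le> 2"
    using assms(2) by (simp add: Z_diamond_def)
  with assms(1) show ?thesis
    unfolding F_diamond_def mem_Collect_eq by blast
qed

lemma F_diamondI: "(\<And>k. k \<notin> Z_diamond \<Longrightarrow> H k = 0) \<Longrightarrow> H \<in> F_diamond"
  unfolding F_diamond_def Z_diamond_def by auto

text \<open>Since both factors start at degree 3 and the bracket lowers the total degree by 2, only
  coefficients of degree less than that of \<open>k\<close> enter.\<close>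

lemma quad_truncate:
  assumes "H \<in> F_diamond"
  shows "quad \<omega> (truncate (mdeg k) H) k = quad \<omega> H k"
proof -
  have H: "H m = 0" if "mdeg m \<le> 2" for m
    using assms that by (intro F_diamond_eq_0) (auto simp: Z_diamond_def)
  have *: "xi_star \<omega> (truncate (mdeg k) H) (l + a) * truncate (mdeg k) H (m + b) =
      xi_star \<omega> H (l + a) * H (m + b)"
    if "l + m = k" "mdeg a = 1" "mdeg b = 1" for l m a b
  proof -
    have "mdeg (l + a) + mdeg (m + b) = mdeg k + 2"
      using that by (auto simp: mdeg_add)
    \<comment> \<open>If both degrees are at least 3, each is at most \<open>mdeg k - 1\<close> and
      truncation changes nothing; otherwise one factor vanishes on either side.\<close>
    then show ?thesis
      by (cases "mdeg (l + a) \<le> 2"; cases "mdeg (m + b) \<le> 2")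
        (auto simp: xi_star_def truncate_def H Z_diamond_def)
  qed
  show ?thesis
    unfolding quad_def poisson_expand split_def
  proof (intro sum.cong refl)
    fix j and x :: "'a mindex \<times> 'a mindex"
    assume "x \<in> {p. fst p + snd p = k}"
    then have "fst x + snd x = k" by simp
    note *[OF this mdeg_axis(1,2)] *[OF this mdeg_axis(2,1)]
    then show "\<i> * of_nat (snd (fst x) $ j + 1) * of_nat (fst (snd x) $ j + 1) *
        (xi_star \<omega> (truncate (mdeg k) H) (fst x + (0, axis j 1)) *
          truncate (mdeg k) H (snd x + (axis j 1, 0)))
      - \<i> * of_nat (fst (fst x) $ j + 1) * of_nat (snd (snd x) $ j + 1) *
        (xi_star \<omega> (truncate (mdeg k) H) (fst x + (axis j 1, 0)) *
          truncate (mdeg k) H (snd x + (0, axis j 1))) =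
      \<i> * of_nat (snd (fst x) $ j + 1) * of_nat (fst (snd x) $ j + 1) *
        (xi_star \<omega> H (fst x + (0, axis j 1)) * H (snd x + (axis j 1, 0)))
      - \<i> * of_nat (fst (fst x) $ j + 1) * of_nat (snd (snd x) $ j + 1) *
        (xi_star \<omega> H (fst x + (axis j 1, 0)) * H (snd x + (0, axis j 1)))"
      by (simp only:)
  qed
qed

text \<open>The factors \<open>\<i>\<close> of \<open>poisson_H2\<close> and \<open>- \<i>\<close>
  of \<open>xi_star\<close> multiply to 1, and a frequency times its sign is its absolute value. So
  the linear part of the flow is damping.\<close>

lemma poisson_xi_star:
  assumes "H \<in> F_diamond"
  shows "poisson (xi_star \<omega> H) (\<lambda>m. H2 \<omega> m + H m) k =
    of_real \<bar>freq \<omega> (mdiff k)\<bar> * H k + quad \<omega> H k"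
proof -
  have xi: "xi_star \<omega> H k = - \<i> * of_real (sgn (freq \<omega> (mdiff k))) * H k"
    using F_diamond_eq_0 [OF assms, of k] by (simp add: xi_star_def)
  have "\<i> * r * (- \<i> * s * x) = r * s * x" for r s x :: complex
    by (simp add: algebra_simps)
  then have "poisson (xi_star \<omega> H) (H2 \<omega>) k =
      of_real (freq \<omega> (mdiff k) * sgn (freq \<omega> (mdiff k))) * H k"
    unfolding poisson_H2 xi of_real_mult .
  then show ?thesis
    unfolding poisson_add_right quad_def abs_sgn by (simp only:)
qed

text \<open>Truncation below a degree of at most 2 leaves the zero series. The equations of low
  degree thus read \<open>0 = 0\<close> along \<open>sol\<close>.\<close>

lemma quad_eq_0:
  assumes "H \<in> F_diamond" "k \<notin> Z_diamond"
  shows "quad \<omega> H k = 0"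
proof -
  have "truncate (mdeg k) H = (\<lambda>_. 0)"
    using assms by (auto simp: truncate_def F_diamond_def Z_diamond_def)
  moreover have "quad \<omega> (\<lambda>_. 0) k = 0"
    by (simp add: quad_def poisson_expand)
  ultimately show ?thesis
    using quad_truncate [OF assms(1), of \<omega> k] by simp
qed

lemma quad_cong:
  assumes "G \<in> F_diamond" "H \<in> F_diamond" "\<And>m. mdeg m < mdeg k \<Longrightarrow> G m = H m"
  shows "quad \<omega> G k = quad \<omega> H k"
proof -
  have "truncate (mdeg k) G = truncate (mdeg k) H"
    using assms(3) by (auto simp: truncate_def)
  then show ?thesis
    using quad_truncate [OF assms(1), of \<omega> k] quad_truncate [OF assms(2), of \<omega> k] by simp
qed

text \<open>With weights \<open>exp (\<omega>\<^sub>m t)\<close>, a product of the coefficients at \<open>l\<close> and \<open>m\<close> acquires the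
  factor \<open>exp (- \<nu> t)\<close> with \<open>\<nu> = \<omega>\<^sub>l + \<omega>\<^sub>m - \<omega>\<^sub>k \<ge> 0\<close>. If \<open>\<omega>\<^sub>k = 0\<close> then \<open>\<omega>\<^sub>l = \<omega>\<^sub>m\<close>, so either
  \<open>\<nu> > 0\<close> or \<open>\<sigma>\<^sub>l = 0\<close>.\<close>

lemma quad_exp_polys:
  fixes k :: "'n::finite mindex" and g :: "'n series \<Rightarrow> real \<Rightarrow> 'n series"
  assumes g: "\<And>m. (\<lambda>X t. of_real (exp (\<bar>freq \<omega> (mdiff m)\<bar> * t)) * g X t m) \<in> exp_polys A {(s, \<nu>). 0 \<le> \<nu>}"
  shows "(\<lambda>X t. of_real (exp (\<bar>freq \<omega> (mdiff k)\<bar> * t)) * quad \<omega> (g X t) k)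
    \<in> exp_polys A {(s, \<nu>). 0 \<le> \<nu> \<and> (mdiff k \<in> L_res \<omega> \<longrightarrow> 0 < \<nu>)}" (is "_ \<in> exp_polys A ?B")
proof -
  define w :: "'n mindex \<Rightarrow> real" where "w m = \<bar>freq \<omega> (mdiff m)\<bar>" for m
  \<comment> \<open>Here \<open>l\<close> and \<open>m\<close> are the indices already shifted by
    unit vectors, so they need not sum to \<open>k\<close>; only their \<open>mdiff\<close> adds
    up.\<close>
  have *: "(\<lambda>X t. a * (of_real (exp (w k * t)) * (xi_star \<omega> (g X t) l * g X t m))) \<in> exp_polys A ?B"
    if lm: "mdiff l + mdiff m = mdiff k" for a l m
  proof (cases "l \<in> Z_diamond \<and> freq \<omega> (mdiff l) \<noteq> 0")
    case False
    then have "xi_star \<omega> (g X t) l = 0" for X t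
      by (auto simp: xi_star_def)
    then show ?thesis
      by (simp add: exp_polys.zero)
  next
    case True
    define \<nu> where "\<nu> = w l + w m - w k"
    have f: "freq \<omega> (mdiff l) + freq \<omega> (mdiff m) = freq \<omega> (mdiff k)"
      by (simp add: lm flip: freq_add)
    have \<nu>: "(0, \<nu>) \<in> ?B"
      using f True by (auto simp: \<nu>_def w_def L_res_def)
    have "(\<lambda>X t. of_real (exp (w l * t)) * g X t l * (of_real (exp (w m * t)) * g X t m))
        \<in> exp_polys A {(s, \<nu>). 0 \<le> \<nu>}"
      by (rule exp_polys_mult [OF g g, folded w_def]) auto
    \<comment> \<open>The other factors only contribute rates \<open>\<ge> 0\<close>, so the strict
      positivity in the resonant case survives the product.\<close>
    then have "(\<lambda>X t. of_real (exp (- \<nu> * t)) * (of_real (exp (w l * t)) * g X t l *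
        (of_real (exp (w m * t)) * g X t m))) \<in> exp_polys A ?B"
      by (rule exp_polys_mult [OF exp_polys_exp [OF \<nu>]]) auto
    from exp_polys_cmult [OF this, of "a * (- \<i> * of_real (sgn (freq \<omega> (mdiff l))))"]
    show ?thesis
    proof (rule back_subst [of "\<lambda>f. f \<in> exp_polys A ?B"], intro ext)
      fix X t
      have "exp (- \<nu> * t) * exp (w l * t) * exp (w m * t) = exp (w k * t)"
        by (simp add: \<nu>_def algebra_simps flip: exp_add)
      then have e: "complex_of_real (exp (w k * t)) =
          of_real (exp (- \<nu> * t)) * of_real (exp (w l * t)) * of_real (exp (w m * t))"
        by (simp flip: of_real_mult)
      show "a * (- \<i> * of_real (sgn (freq \<omega> (mdiff l)))) * (of_real (exp (- \<nu> * t)) *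
          (of_real (exp (w l * t)) * g X t l * (of_real (exp (w m * t)) * g X t m))) =
          a * (of_real (exp (w k * t)) * (xi_star \<omega> (g X t) l * g X t m))"
        using True unfolding e by (simp add: xi_star_def)
    qed
  qed
  have "(\<lambda>X t. \<Sum>j\<in>UNIV. \<Sum>p\<in>{(l, m). l + m = k}.
     \<i> * of_nat (snd (fst p) $ j + 1) * of_nat (fst (snd p) $ j + 1) * (of_real (exp (w k * t)) *
       (xi_star \<omega> (g X t) (fst p + (0, axis j 1)) * g X t (snd p + (axis j 1, 0))))
     - \<i> * of_nat (fst (fst p) $ j + 1) * of_nat (snd (snd p) $ j + 1) * (of_real (exp (w k * t)) *
       (xi_star \<omega> (g X t) (fst p + (axis j 1, 0)) * g X t (snd p + (0, axis j 1))))) \<in> exp_polys A ?B"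
    by (intro exp_polys_sum exp_polys_diff *)
      (simp_all only: mdiff_add_axis mem_Collect_eq split_def)
  then show ?thesis
    unfolding w_def [symmetric] quad_def poisson_expand sum_distrib_left split_def
      right_diff_distrib mult.left_commute [of "complex_of_real (exp (w k * _))"] .
qed

subsection \<open>The solution\<close>

text \<open>The oriented integral from 0, so negative times need no separate treatment.\<close>

definition primitive :: "(real \<Rightarrow> complex) \<Rightarrow> real \<Rightarrow> complex" where
  "primitive f = (SOME F. F 0 = 0 \<and> (\<forall>t. (F has_vector_derivative f t) (at t)))"

lemma primitive_eqI:
  assumes "F 0 = 0" "\<And>t. (F has_vector_derivative f t) (at t)"
  shows "primitive f = F"
  unfolding primitive_def
proof (rule some_equality)
  fix G
  assume G: "G 0 = 0 \<and> (\<forall>t. (G has_vector_derivative f t) (at t))"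
  have "((\<lambda>t. G t - F t) has_vector_derivative 0) (at t)" for t
    using has_vector_derivative_diff [of G "f t" "at t" F "f t"] G assms(2) by simp
  then obtain c where "\<And>t. G t - F t = c"
    using has_vector_derivative_zero_constant [of UNIV "\<lambda>t. G t - F t"] by auto
  with G assms(1) have "\<And>t. G t - F t = 0"
    by (metis diff_self)
  then show "G = F" by auto
qed (use assms in simp)

text \<open>Variation of constants. The choice in \<open>primitive\<close> is meaningful because the integrand turns
  out to be an exponential polynomial (\<open>sol_exp_polys\<close>).\<close>

function sol :: "real ^ 'n::finite \<Rightarrow> 'n series \<Rightarrow> 'n mindex \<Rightarrow> real \<Rightarrow> complex" where
  "sol \<omega> X k t = (if k \<in> Z_diamond
     then of_real (exp (- \<bar>freq \<omega> (mdiff k)\<bar> * t)) * (X k - primitive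
       (\<lambda>u. of_real (exp (\<bar>freq \<omega> (mdiff k)\<bar> * u)) *
         quad \<omega> (\<lambda>m. if mdeg m < mdeg k then sol \<omega> X m u else 0) k) t)
     else 0)"
  by pat_completeness auto
termination
  \<comment> \<open>The guard \<open>mdeg m < mdeg k\<close> lowers the degree in every call. It
    loses no information, since \<open>quad\<close> at \<open>k\<close> reads only these
    coefficients (\<open>quad_truncate\<close>).\<close>
  by (relation "Wellfounded.measure (\<lambda>(\<omega>, X, k, t). mdeg k)") auto

declare sol.simps [simp del]

lemma sol_F_diamond: "(\<lambda>k. sol \<omega> X k t) \<in> F_diamond"
  by (rule F_diamondI) (simp add: sol.simps)

text \<open>The extra factor \<open>x\<close> lets the simplifier cancel the weights inside products
  bracketed to the right.\<close>

lemma exp_mult_exp_neg [simp]: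
  "complex_of_real (exp (a * t)) * (of_real (exp (- (a * t))) * x) = x"
  "complex_of_real (exp (- (a * t))) * (of_real (exp (a * t)) * x) = x"
proof -
  have "exp (a * t) * exp (- (a * t)) = 1"
    by (simp flip: exp_add)
  then have *: "complex_of_real (exp (a * t)) * of_real (exp (- (a * t))) = 1"
    by (metis of_real_1 of_real_mult)
  show "complex_of_real (exp (a * t)) * (of_real (exp (- (a * t))) * x) = x"
    unfolding mult.assoc [symmetric] * by simp
  show "complex_of_real (exp (- (a * t))) * (of_real (exp (a * t)) * x) = x"
    unfolding mult.left_commute [of "complex_of_real (exp (- (a * t)))"]
    unfolding mult.assoc [symmetric] * by simp
qed

text \<open>Induction on the degree: weighted lower coefficients are exponential polynomials,
  \<open>quad_exp_polys\<close> carries this to the integrand and \<open>exp_polys_primitive\<close>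
  to its integral. The choice of \<open>p\<close> precedes \<open>X\<close>, because the final
  polynomial must not depend on the initial data.\<close>

lemma sol_exp_polys:
  fixes \<omega> :: "real ^ 'n::finite"
  assumes "k \<in> Z_diamond"
  shows "\<exists>p \<in> exp_polys {m \<in> Z_diamond. mdeg m < mdeg k}
      {(s, \<nu>). 0 \<le> \<nu> \<and> (mdiff k \<in> L_res \<omega> \<and> \<nu> = 0 \<longrightarrow> s = 0)}.
    \<forall>X. p X 0 = 0 \<and>
      (\<forall>t. sol \<omega> X k t = of_real (exp (- \<bar>freq \<omega> (mdiff k)\<bar> * t)) * (X k + p X t) \<and>
        (p X has_vector_derivative
          - (of_real (exp (\<bar>freq \<omega> (mdiff k)\<bar> * t)) * quad \<omega> (\<lambda>m. sol \<omega> X m t) k)) (at t))"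
  using assms
proof (induction "mdeg k" arbitrary: k rule: less_induct)
  case less
  define w where "w = \<bar>freq \<omega> (mdiff k)\<bar>"
  let ?B = "{(s, \<nu>). 0 \<le> \<nu> \<and> (mdiff k \<in> L_res \<omega> \<and> \<nu> = 0 \<longrightarrow> s = 0)} :: (nat \<times> real) set"
  define A where "A = {m :: 'n mindex. m \<in> Z_diamond \<and> mdeg m < mdeg k}"
  \<comment> \<open>Truncation matches the guard in \<open>sol\<close> and leaves only coefficients
    covered by the induction hypothesis.\<close>
  define g where "g X t = truncate (mdeg k) (\<lambda>m. sol \<omega> X m t)" for X t
  have "(\<lambda>X t. of_real (exp (\<bar>freq \<omega> (mdiff m)\<bar> * t)) * g X t m) \<in> exp_polys A {(s, \<nu>). 0 \<le> \<nu>}" for m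
  proof (cases "m \<in> A")
    case True
    with less.hyps [of m] obtain p where
      p: "p \<in> exp_polys {m' \<in> Z_diamond. mdeg m' < mdeg m}
        {(s, \<nu>). 0 \<le> \<nu> \<and> (mdiff m \<in> L_res \<omega> \<and> \<nu> = 0 \<longrightarrow> s = 0)}"
      and sol: "\<And>X t. sol \<omega> X m t = of_real (exp (- \<bar>freq \<omega> (mdiff m)\<bar> * t)) * (X m + p X t)"
      unfolding A_def by blast
    have "(\<lambda>X t. X m + p X t) \<in> exp_polys A {(s, \<nu>). 0 \<le> \<nu>}"
      using True by (intro exp_polys_add exp_polys_var exp_polys_mono [OF p]) (auto simp: A_def)
    then show ?thesis
      using True by (simp add: g_def truncate_def sol A_def)
  next
    case False
    then have "g X t m = 0" for X t
      using F_diamond_eq_0 [OF sol_F_diamond, of m \<omega> X t]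
      by (cases "m \<in> Z_diamond") (simp_all add: g_def truncate_def A_def)
    then show ?thesis
      by (simp add: exp_polys.zero)
  qed
  from quad_exp_polys [OF this, of k]
  have "\<exists>F \<in> exp_polys A ?B. \<forall>X. F X 0 = 0 \<and> (\<forall>t. (F X has_vector_derivative
      of_real (exp (w * t)) * quad \<omega> (g X t) k) (at t))"
    unfolding w_def [symmetric] by (rule exp_polys_primitive) (auto simp: less_le)
  then obtain F where F: "F \<in> exp_polys A ?B" and F0: "\<And>X. F X 0 = 0"
    and dF: "\<And>X t. (F X has_vector_derivative of_real (exp (w * t)) * quad \<omega> (g X t) k) (at t)"
    by blast
  have sol: "sol \<omega> X k t = of_real (exp (- w * t)) * (X k - F X t)" for X t
    using primitive_eqI [OF F0 dF, of X] less.prems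
    by (subst sol.simps) (simp add: w_def g_def truncate_def)
  have q: "quad \<omega> (g X t) k = quad \<omega> (\<lambda>m. sol \<omega> X m t) k" for X t
    unfolding g_def by (rule quad_truncate [OF sol_F_diamond])
  have "((\<lambda>t. - F X t) has_vector_derivative
      - (of_real (exp (w * t)) * quad \<omega> (\<lambda>m. sol \<omega> X m t) k)) (at t)" for X t
    unfolding q [symmetric] by (rule has_vector_derivative_minus [OF dF])
  moreover have "(\<lambda>X t. - F X t) \<in> exp_polys A ?B"
    using exp_polys_cmult [OF F, of "-1"] by simp
  ultimately show ?case
    unfolding w_def [symmetric] A_def [symmetric]
    by (intro bexI [of _ "\<lambda>X t. - F X t"]) (simp_all add: F0 sol)
qed

section \<open>Existence, uniqueness and identification of the flow\<close>

lemma solves_sol: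
  assumes "X \<in> F_diamond"
  shows "solves \<omega> X I (\<lambda>t k. sol \<omega> X k t)"
  unfolding solves_def
proof (intro conjI ballI allI sol_F_diamond)
  show "(\<lambda>k. sol \<omega> X k 0) = X"
  proof
    fix k
    show "sol \<omega> X k 0 = X k"
    proof (cases "k \<in> Z_diamond")
      case True
      from sol_exp_polys [OF this, of \<omega>] obtain p where
        p0: "p X 0 = 0" and
        sol: "\<And>t. sol \<omega> X k t = of_real (exp (- \<bar>freq \<omega> (mdiff k)\<bar> * t)) * (X k + p X t)"
        by blast
      show ?thesis by (simp add: sol p0)
    next
      case False
      then show ?thesis
        using F_diamond_eq_0 [OF assms] by (simp add: sol.simps)
    qed
  qed
next
  fix t k
  \<comment> \<open>The equation is proved on the whole line by the product rule; restricting the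
    derivative then serves every \<open>I\<close>.\<close>
  have "((\<lambda>t. sol \<omega> X k t) has_vector_derivative
      - (of_real \<bar>freq \<omega> (mdiff k)\<bar> * sol \<omega> X k t + quad \<omega> (\<lambda>k. sol \<omega> X k t) k)) (at t)"
  proof (cases "k \<in> Z_diamond")
    case True
    define w where "w = \<bar>freq \<omega> (mdiff k)\<bar>"
    from sol_exp_polys [OF True, of \<omega>] obtain p where
      sol: "\<And>t. sol \<omega> X k t = of_real (exp (- w * t)) * (X k + p X t)" and
      dp: "\<And>t. (p X has_vector_derivative - (of_real (exp (w * t)) * quad \<omega> (\<lambda>m. sol \<omega> X m t) k)) (at t)"
      unfolding w_def by blast
    have "((\<lambda>t. exp (- w * t)) has_real_derivative (- w * exp (- w * t))) (at t)"
      by (rule derivative_eq_intros refl | simp)+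
    from has_vector_derivative_mult [OF has_vector_derivative_of_real [OF this]
        has_vector_derivative_add [OF has_vector_derivative_const [of "X k"] dp]]
    show ?thesis
      unfolding w_def [symmetric] sol by (simp add: algebra_simps)
  next
    case False
    then have "sol \<omega> X k = (\<lambda>t. 0)"
      by (auto simp: sol.simps)
    then show ?thesis
      using False by (simp add: quad_eq_0 [OF sol_F_diamond])
  qed
  then show "((\<lambda>t. sol \<omega> X k t) has_vector_derivative
      - poisson (xi_star \<omega> (\<lambda>k. sol \<omega> X k t)) (\<lambda>m. H2 \<omega> m + sol \<omega> X m t) k) (at t within I)"
    by (simp add: poisson_xi_star [OF sol_F_diamond] has_vector_derivative_at_within)
qed

text \<open>Once the lower coefficients agree, the quadratic parts cancel in the difference, and the
  weight \<open>exp (w * u)\<close> absorbs the linear part. The weighted difference is constant on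
  the interval and 0 at time 0.\<close>

lemma solves_unique:
  assumes I: "is_interval I" "0 \<in> I" and H: "solves \<omega> X I H" and G: "solves \<omega> X I G" and "t \<in> I"
  shows "H t = G t"
proof
  fix k
  have F: "H t \<in> F_diamond" "G t \<in> F_diamond" if "t \<in> I" for t
    using H G that by (auto simp: solves_def)
  show "H t k = G t k"
    using \<open>t \<in> I\<close>
  \<comment> \<open>The time is generalised too: a vanishing derivative on all of \<open>I\<close>
    needs the lower coefficients to agree on all of \<open>I\<close>.\<close>
  proof (induction "mdeg k" arbitrary: k t rule: less_induct)
    case less
    define w where "w = \<bar>freq \<omega> (mdiff k)\<bar>"
    have D: "((\<lambda>u. of_real (exp (w * u)) * (H u k - G u k)) has_vector_derivative 0) (at u within I)"
      if u: "u \<in> I" for u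
    proof -
      have q: "quad \<omega> (H u) k = quad \<omega> (G u) k"
        using less.hyps u by (intro quad_cong F)
      have dH: "((\<lambda>u. H u k) has_vector_derivative - (of_real w * H u k + quad \<omega> (H u) k)) (at u within I)"
        using H u unfolding solves_def w_def poisson_xi_star [OF F(1) [OF u], symmetric] by blast
      have dG: "((\<lambda>u. G u k) has_vector_derivative - (of_real w * G u k + quad \<omega> (G u) k)) (at u within I)"
        using G u unfolding solves_def w_def poisson_xi_star [OF F(2) [OF u], symmetric] by blast
      have "((\<lambda>u. exp (w * u)) has_real_derivative (w * exp (w * u))) (at u within I)"
        by (rule derivative_eq_intros refl | simp)+
      from has_vector_derivative_mult [OF has_vector_derivative_of_real [OF this]
          has_vector_derivative_diff [OF dH dG]]
      show ?thesis
        by (simp add: q algebra_simps)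
    qed
    obtain c where "\<And>u. u \<in> I \<Longrightarrow> of_real (exp (w * u)) * (H u k - G u k) = c"
      using has_vector_derivative_zero_constant [OF is_interval_convex [OF I(1)] D] by blast
    moreover have "H 0 = G 0"
      using H G by (simp add: solves_def)
    ultimately have "of_real (exp (w * t)) * (H t k - G t k) = 0"
      using I(2) less.prems by (metis diff_self mult_zero_right)
    then show ?case by simp
  qed
qed

lemma uniquely_solvable:
  assumes "X \<in> F_diamond" "is_interval I" "0 \<in> I"
  shows "uniquely_solvable \<omega> X I"
  unfolding uniquely_solvable_def
proof (intro conjI allI impI ballI)
  show "\<exists>H. solves \<omega> X I H"
    by (rule exI, rule solves_sol [OF assms(1)])
qed (rule solves_unique [OF assms(2,3)])

text \<open>The interval \<open>UNIV\<close> provides a witness. Any other admissible interval gives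
  the same value at \<open>t\<close>, because \<open>sol\<close> solves the problem there as
  well.\<close>

lemma flow_eq_sol:
  assumes "X \<in> F_diamond"
  shows "flow \<omega> t X = (\<lambda>k. sol \<omega> X k t)"
  unfolding flow_def
proof (rule the_equality)
  show "\<exists>I H. is_interval I \<and> 0 \<in> I \<and> t \<in> I \<and> uniquely_solvable \<omega> X I \<and> solves \<omega> X I H \<and>
      H t = (\<lambda>k. sol \<omega> X k t)"
    by (intro exI [of _ UNIV] exI [of _ "\<lambda>t k. sol \<omega> X k t"] conjI)
      (simp_all add: uniquely_solvable solves_sol assms)
next
  fix G
  assume "\<exists>I H. is_interval I \<and> 0 \<in> I \<and> t \<in> I \<and> uniquely_solvable \<omega> X I \<and> solves \<omega> X I H \<and> H t = G"
  then obtain I H where I: "is_interval I" "0 \<in> I" "t \<in> I" and H: "solves \<omega> X I H" "H t = G"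
    by (elim exE conjE)
  show "G = (\<lambda>k. sol \<omega> X k t)"
    unfolding H(2) [symmetric] by (rule solves_unique [OF I(1,2) H(1) solves_sol [OF assms] I(3)])
qed

theorem theorem1:
  fixes \<omega> :: "real ^ 'n"
  shows "(\<forall>Hhat \<in> F_diamond. \<forall>I. is_interval I \<and> 0 \<in> I \<longrightarrow> uniquely_solvable \<omega> Hhat I) \<and>
    (\<forall>k \<in> Z_diamond. \<exists>P :: 'n coeff_poly.
       (\<forall>\<mu> \<in> Poly_Mapping.keys P. \<forall>m \<in> Poly_Mapping.keys \<mu>. m \<in> Z_diamond \<and> mdeg m < mdeg k) \<and>
       (\<forall>\<mu> \<in> Poly_Mapping.keys P. \<forall>(s, \<nu>) \<in> Poly_Mapping.keys (Poly_Mapping.lookup P \<mu>).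
          0 \<le> \<nu> \<and> (mdiff k \<in> L_res \<omega> \<and> \<nu> = 0 \<longrightarrow> s = 0)) \<and>
       (\<forall>Hhat \<in> F_diamond. \<forall>\<delta>.
          flow \<omega> \<delta> Hhat k * of_real (exp (\<bar>freq \<omega> (mdiff k)\<bar> * \<delta>)) =
          Hhat k + eval_coeff_poly P Hhat \<delta>))"
proof (intro conjI ballI allI impI)
  fix Hhat :: "'n series" and I :: "real set"
  assume "Hhat \<in> F_diamond" "is_interval I \<and> 0 \<in> I"
  then show "uniquely_solvable \<omega> Hhat I"
    by (simp add: uniquely_solvable)
next
  fix k :: "'n mindex"
  assume "k \<in> Z_diamond"
  from sol_exp_polys [OF this, of \<omega>] obtain p where
    p: "p \<in> exp_polys {m \<in> Z_diamond. mdeg m < mdeg k}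
      {(s, \<nu>). 0 \<le> \<nu> \<and> (mdiff k \<in> L_res \<omega> \<and> \<nu> = 0 \<longrightarrow> s = 0)}"
    and sol: "\<And>X t. sol \<omega> X k t = of_real (exp (- \<bar>freq \<omega> (mdiff k)\<bar> * t)) * (X k + p X t)"
    by blast
  from exp_polys_imp_coeff_poly [OF p] obtain P where
    P: "\<forall>\<mu> \<in> Poly_Mapping.keys P. Poly_Mapping.keys \<mu> \<subseteq> {m \<in> Z_diamond. mdeg m < mdeg k} \<and>
      Poly_Mapping.keys (Poly_Mapping.lookup P \<mu>) \<subseteq>
        {(s, \<nu>). 0 \<le> \<nu> \<and> (mdiff k \<in> L_res \<omega> \<and> \<nu> = 0 \<longrightarrow> s = 0)}"
    and eval: "\<forall>X t. p X t = eval_coeff_poly P X t"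
    by (elim exE conjE) (rule that)
  note keys = P [rule_format, THEN conjunct1] P [rule_format, THEN conjunct2]
  show "\<exists>P :: 'n coeff_poly.
       (\<forall>\<mu> \<in> Poly_Mapping.keys P. \<forall>m \<in> Poly_Mapping.keys \<mu>. m \<in> Z_diamond \<and> mdeg m < mdeg k) \<and>
       (\<forall>\<mu> \<in> Poly_Mapping.keys P. \<forall>(s, \<nu>) \<in> Poly_Mapping.keys (Poly_Mapping.lookup P \<mu>).
          0 \<le> \<nu> \<and> (mdiff k \<in> L_res \<omega> \<and> \<nu> = 0 \<longrightarrow> s = 0)) \<and>
       (\<forall>Hhat \<in> F_diamond. \<forall>\<delta>.
          flow \<omega> \<delta> Hhat k * of_real (exp (\<bar>freq \<omega> (mdiff k)\<bar> * \<delta>)) =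
          Hhat k + eval_coeff_poly P Hhat \<delta>)"
  proof (intro exI [of _ P] conjI ballI allI)
    fix \<mu> m
    assume "\<mu> \<in> Poly_Mapping.keys P" "m \<in> Poly_Mapping.keys \<mu>"
    then have "m \<in> {m \<in> Z_diamond. mdeg m < mdeg k}"
      by (rule subsetD [OF keys(1)])
    then show "m \<in> Z_diamond" "mdeg m < mdeg k"
      by simp_all
  next
    fix \<mu> x
    assume "\<mu> \<in> Poly_Mapping.keys P" "x \<in> Poly_Mapping.keys (Poly_Mapping.lookup P \<mu>)"
    then have "x \<in> {(s, \<nu>). 0 \<le> \<nu> \<and> (mdiff k \<in> L_res \<omega> \<and> \<nu> = 0 \<longrightarrow> s = 0)}"
      by (rule subsetD [OF keys(2)])
    then show "case x of (s, \<nu>) \<Rightarrow> 0 \<le> \<nu> \<and> (mdiff k \<in> L_res \<omega> \<and> \<nu> = 0 \<longrightarrow> s = 0)"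
      by (simp only: mem_Collect_eq)
  next
    fix Hhat :: "'n series" and \<delta> :: real
    assume "Hhat \<in> F_diamond"
    show "flow \<omega> \<delta> Hhat k * of_real (exp (\<bar>freq \<omega> (mdiff k)\<bar> * \<delta>)) =
        Hhat k + eval_coeff_poly P Hhat \<delta>"
      \<comment> \<open>After commuting, the weight stands in front of its inverse and
        \<open>exp_mult_exp_neg\<close> cancels the two.\<close>
      unfolding flow_eq_sol [OF \<open>Hhat \<in> F_diamond\<close>] sol eval [rule_format]
      by (subst mult.commute) simp
  qed
qed

end
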